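(* Let $Q=(q_{ij})$ be a real symmetric $n\times n$ matrix with zero diagonal, let $c\in\mathbb{R}^n$, and let $R_i=\{j: q_{ij}\neq 0\}$ for $i=1,\dots,n$. Consider the mixed integer linear program PK in variables $x_i$ ($i=1,\dots,n$) and $y_{ij}$ ($j\in R_i$, $i=1,\dots,n$): maximize $\sum_{i=1}^n\sum_{j\in R_i}q_{ij}y_{ij}+\sum_{i=1}^n c_ix_i$ subject to $x_i+x_j-y_{ij}\le 1$ for all $j\in R_i$, $i=1,\dots,n$; $y_{ij}+y_{ji}-2x_i\le 0$ for all $j\in R_i$, $i=1,\dots,n$; $x_i\in\{0,1\}$ for all $i$; $y_{ij}\ge 0$ for all $j\in R_i$, $i=1,\dots,n$. Then PK is a valid MILP formulation of QUBO.
   Context: QUBO (quadratic unconstrained binary optimization) is the problem: maximize $\sum_{i=1}^n\sum_{j\in R_i}q_{ij}x_ix_j+\sum_{i=1}^n c_ix_i$ over $x\in\{0,1\}^n$. Since $Q$ is symmetric, $j\in R_i$ iff $i\in R_j$, so $y_{ij}$ is defined iff $y_{ji}$ is. An MILP in variables $(x,y)$ with the objective $\sum_i\sum_{j\in R_i}q_{ij}y_{ij}+\sum_i c_ix_i$ is called a valid formulation of QUBO if its optimal objective value equals the optimal value of QUBO and the $x$-part of every optimal solution of the MILP is an optimal solution of QUBO. *)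

theory Defs
  imports "HOL-Analysis.Analysis"
begin

text \<open>Vectors of length \<open>n\<close> are elements of \<open>real ^ 'n\<close> with \<open>n = CARD('n)\<close>.\<close>

definition nbrs :: "real ^ 'n ^ 'n \<Rightarrow> 'n \<Rightarrow> 'n set" where
  "nbrs Q i = {j. Q $ i $ j \<noteq> 0}"

definition pairs :: "real ^ 'n ^ 'n \<Rightarrow> ('n \<times> 'n) set" where
  "pairs Q = (SIGMA i:UNIV. nbrs Q i)"

definition is_optimal_value :: "('a \<Rightarrow> real) \<Rightarrow> 'a set \<Rightarrow> real \<Rightarrow> bool" where
  "is_optimal_value f S v \<longleftrightarrow> (\<exists>s. is_arg_max f (\<lambda>s. s \<in> S) s \<and> f s = v)"

definition binary_vectors :: "(real ^ 'n) set" where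
  "binary_vectors = {x. \<forall>i. x $ i \<in> {0, 1}}"

definition qubo_obj :: "real ^ 'n ^ 'n \<Rightarrow> real ^ 'n \<Rightarrow> real ^ 'n \<Rightarrow> real" where
  "qubo_obj Q c x =
     (\<Sum>i\<in>UNIV. \<Sum>j\<in>nbrs Q i. Q $ i $ j * x $ i * x $ j) + (\<Sum>i\<in>UNIV. c $ i * x $ i)"

text \<open>The variables \<open>y i j\<close> exist only for \<open>j \<in> nbrs Q i\<close>. A value assignment to them is
  a function on pairs that is extensional on \<^term>\<open>pairs Q\<close>, so that distinct points
  \<open>(x, y)\<close> really differ in the value of some variable.\<close>

type_synonym 'n point = "(real ^ 'n) \<times> ('n \<times> 'n \<Rightarrow> real)"

definition linearized_obj :: "real ^ 'n ^ 'n \<Rightarrow> real ^ 'n \<Rightarrow> 'n point \<Rightarrow> real" where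
  "linearized_obj Q c = (\<lambda>(x, y).
     (\<Sum>i\<in>UNIV. \<Sum>j\<in>nbrs Q i. Q $ i $ j * y (i, j)) + (\<Sum>i\<in>UNIV. c $ i * x $ i))"

text \<open>A set is the feasible region of an MILP in the variables \<open>(x, y)\<close> if it is cut out by
  finitely many linear inequalities \<open>a \<bullet> x + b \<bullet> y \<le> \<beta>\<close>, encoded as triples \<open>(a, b, \<beta>)\<close>,
  together with integrality of some of the variables.\<close>

definition milp_region :: "real ^ 'n ^ 'n \<Rightarrow> 'n point set \<Rightarrow> bool" where
  "milp_region Q F \<longleftrightarrow>
     (\<exists>(C :: ((real ^ 'n) \<times> ('n \<times> 'n \<Rightarrow> real) \<times> real) set) I J.
        finite C \<and> J \<subseteq> pairs Q \<and>
        F = {(x, y). y \<in> extensional (pairs Q) \<and>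
               (\<forall>(a, b, \<beta>)\<in>C.
                  (\<Sum>i\<in>UNIV. a $ i * x $ i) + (\<Sum>p\<in>pairs Q. b p * y p) \<le> \<beta>) \<and>
               (\<forall>i\<in>I. x $ i \<in> \<int>) \<and> (\<forall>p\<in>J. y p \<in> \<int>)})"

definition valid_MILP_formulation ::
    "real ^ 'n ^ 'n \<Rightarrow> real ^ 'n \<Rightarrow> 'n point set \<Rightarrow> bool" where
  "valid_MILP_formulation Q c F \<longleftrightarrow>
     milp_region Q F \<and>
     (\<exists>v. is_optimal_value (linearized_obj Q c) F v \<and>
          is_optimal_value (qubo_obj Q c) binary_vectors v) \<and>
     (\<forall>x y. is_arg_max (linearized_obj Q c) (\<lambda>s. s \<in> F) (x, y) \<longrightarrow>
            is_arg_max (qubo_obj Q c) (\<lambda>x. x \<in> binary_vectors) x)"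

definition PK :: "real ^ 'n ^ 'n \<Rightarrow> 'n point set" where
  "PK Q = {(x, y). y \<in> extensional (pairs Q) \<and>
     (\<forall>i. \<forall>j\<in>nbrs Q i. x $ i + x $ j - y (i, j) \<le> 1) \<and>
     (\<forall>i. \<forall>j\<in>nbrs Q i. y (i, j) + y (j, i) - 2 * x $ i \<le> 0) \<and>
     (\<forall>i. x $ i \<in> {0, 1}) \<and>
     (\<forall>i. \<forall>j\<in>nbrs Q i. y (i, j) \<ge> 0)}"

end

theory Submission
  imports Defs
begin

text \<open>Because \<open>Q\<close> is symmetric, only the sums \<open>y\<^sub>i\<^sub>j + y\<^sub>j\<^sub>i\<close> matter for the objective. For binary
  \<open>x\<close> the constraints force \<open>y\<^sub>i\<^sub>j + y\<^sub>j\<^sub>i = 2 x\<^sub>i x\<^sub>j\<close>, although the single \<open>y\<^sub>i\<^sub>j\<close> may differ from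
  \<open>x\<^sub>i x\<^sub>j\<close>. Hence both objectives agree at every feasible point, not only at optimal ones.\<close>

lemma sum_axis_mult:
  fixes x :: "real ^ 'n"
  shows "(\<Sum>k\<in>UNIV. axis i r $ k * x $ k) = r * x $ i"
proof -
  have "(\<Sum>k\<in>UNIV. axis i r $ k * x $ k) = (\<Sum>k\<in>UNIV. if k = i then r * x $ k else 0)"
    by (rule sum.cong) (auto simp: axis_def)
  then show ?thesis by simp
qed

lemma sum_of_bool_mult:
  fixes y :: "'a \<Rightarrow> real"
  assumes "finite P" "q \<in> P"
  shows "(\<Sum>p\<in>P. of_bool (p = q) * y p) = y q"
proof -
  have "(\<Sum>p\<in>P. of_bool (p = q) * y p) = (\<Sum>p\<in>P. if p = q then y p else 0)"
    by (rule sum.cong) auto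
  then show ?thesis using assms by simp
qed

lemma finite_binary_vectors: "finite (binary_vectors :: (real ^ 'n) set)"
proof -
  \<comment> \<open>A binary vector is the indicator of its support, and a finite index type has
    only finitely many subsets.\<close>
  have "x = (\<chi> i. of_bool (i \<in> {i. x $ i = 1}))" if "x \<in> binary_vectors" for x :: "real ^ 'n"
    using that by (auto simp: binary_vectors_def vec_eq_iff)
  then have "(binary_vectors :: (real ^ 'n) set) \<subseteq> range (\<lambda>A. \<chi> i. of_bool (i \<in> A))"
    by blast
  then show ?thesis
    by (rule finite_subset) simp
qed

lemma ex_is_arg_max_if_finite:
  fixes f :: "'a \<Rightarrow> 'b :: linorder"
  assumes "finite S" "S \<noteq> {}"
  shows "\<exists>s. is_arg_max f (\<lambda>s. s \<in> S) s"
proof -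
  have "Max (f ` S) \<in> f ` S"
    using assms by simp
  then obtain s where s: "s \<in> S" "f s = Max (f ` S)"
    by force
  have "f t \<le> f s" if "t \<in> S" for t
    using assms that by (simp add: s(2))
  then show ?thesis
    using s(1) by (auto simp: is_arg_max_linorder)
qed

text \<open>Comparing \<open>f\<close>-values on \<open>F\<close> amounts to comparing
  \<open>g\<close>-values of images, and surjectivity onto \<open>S\<close> ensures that no
  competitor in \<open>S\<close> is missed. Used with \<open>h = fst\<close>.\<close>

lemma is_arg_max_projection:
  fixes f :: "'a \<Rightarrow> 'c :: linorder" and g :: "'b \<Rightarrow> 'c"
  assumes "h ` F = S" "\<And>s. s \<in> F \<Longrightarrow> f s = g (h s)" "s \<in> F"
  shows "is_arg_max f (\<lambda>s. s \<in> F) s \<longleftrightarrow> is_arg_max g (\<lambda>t. t \<in> S) (h s)"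
  using assms by (force simp: is_arg_max_linorder)

lemma mem_nbrs_sym: "transpose Q = Q \<Longrightarrow> j \<in> nbrs Q i \<longleftrightarrow> i \<in> nbrs Q j"
  by (simp add: nbrs_def vec_eq_iff transpose_def)

text \<open>As \<open>Q\<close> vanishes off \<open>nbrs\<close>, the inner sums extend to all
  indices; then the order of summation can be exchanged and symmetry applied.\<close>

lemma sum_pairs_swap:
  fixes Q :: "real ^ 'n ^ 'n" and g :: "'n \<Rightarrow> 'n \<Rightarrow> real"
  assumes "transpose Q = Q"
  shows "(\<Sum>i\<in>UNIV. \<Sum>j\<in>nbrs Q i. Q $ i $ j * g i j) = (\<Sum>i\<in>UNIV. \<Sum>j\<in>nbrs Q i. Q $ i $ j * g j i)"
proof -
  have full: "(\<Sum>j\<in>nbrs Q i. Q $ i $ j * h j) = (\<Sum>j\<in>UNIV. Q $ i $ j * h j)" for i and h :: "'n \<Rightarrow> real"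
    by (rule sum.mono_neutral_left) (auto simp: nbrs_def)
  have sym: "Q $ i $ j = Q $ j $ i" for i j
    by (metis assms transpose_def vec_lambda_beta)
  have "(\<Sum>i\<in>UNIV. \<Sum>j\<in>UNIV. Q $ i $ j * g i j) = (\<Sum>j\<in>UNIV. \<Sum>i\<in>UNIV. Q $ i $ j * g i j)"
    by (rule sum.swap)
  also have "\<dots> = (\<Sum>j\<in>UNIV. \<Sum>i\<in>UNIV. Q $ j $ i * g i j)"
    by (intro sum.cong refl) (simp add: sym)
  finally show ?thesis
    by (simp add: full)
qed

text \<open>If both endpoints are 1, the first constraint makes each \<open>y\<close> at least 1 and
  the second caps their sum at 2. If one endpoint is 0, the second constraint taken at that endpoint
  and nonnegativity make both \<open>y\<close> vanish. So each \<open>y\<close> even equals the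
  product; only the sum is recorded here.\<close>

lemma PK_sum_eq:
  assumes "transpose Q = Q" "(x, y) \<in> PK Q" "j \<in> nbrs Q i"
  shows "y (i, j) + y (j, i) = 2 * (x $ i * x $ j)"
proof -
  have "i \<in> nbrs Q j"
    using assms mem_nbrs_sym by blast
  then have "x $ i + x $ j - y (i, j) \<le> 1" "x $ j + x $ i - y (j, i) \<le> 1"
    "y (i, j) + y (j, i) - 2 * x $ i \<le> 0" "y (j, i) + y (i, j) - 2 * x $ j \<le> 0"
    "y (i, j) \<ge> 0" "y (j, i) \<ge> 0" "x $ i = 0 \<or> x $ i = 1" "x $ j = 0 \<or> x $ j = 1"
    using assms(2,3) by (auto simp: PK_def)
  then show ?thesis
    by auto
qed

lemma linearized_obj_PK:
  fixes Q :: "real ^ 'n ^ 'n"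
  assumes "transpose Q = Q" "(x, y) \<in> PK Q"
  shows "linearized_obj Q c (x, y) = qubo_obj Q c x"
proof -
  let ?S = "\<lambda>g. \<Sum>i\<in>UNIV. \<Sum>j\<in>nbrs Q i. Q $ i $ j * g i j"
  \<comment> \<open>Doubling symmetrizes the sum, so that \<open>PK_sum_eq\<close> applies term by
    term.\<close>
  have "2 * ?S (\<lambda>i j. y (i, j)) = ?S (\<lambda>i j. y (i, j)) + ?S (\<lambda>i j. y (j, i))"
    using sum_pairs_swap[OF assms(1), of "\<lambda>i j. y (i, j)"] by simp
  also have "\<dots> = ?S (\<lambda>i j. y (i, j) + y (j, i))"
    by (simp add: sum.distrib distrib_left)
  also have "\<dots> = ?S (\<lambda>i j. 2 * (x $ i * x $ j))"
    by (intro sum.cong refl) (simp add: PK_sum_eq[OF assms])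
  also have "\<dots> = 2 * ?S (\<lambda>i j. x $ i * x $ j)"
    by (simp add: sum_distrib_left mult.left_commute)
  finally show ?thesis
    by (simp add: linearized_obj_def qubo_obj_def mult.assoc)
qed

lemma fst_image_PK:
  fixes Q :: "real ^ 'n ^ 'n"
  assumes "transpose Q = Q"
  shows "fst ` PK Q = binary_vectors"
proof (intro equalityI subsetI)
  fix x :: "real ^ 'n" assume x: "x \<in> binary_vectors"
  \<comment> \<open>The product is the natural lift; \<open>restrict\<close> makes it extensional,
    as \<open>PK\<close> demands.\<close>
  let ?y = "restrict (\<lambda>(i, j). x $ i * x $ j) (pairs Q)"
  have mem: "(i, j) \<in> pairs Q" "(j, i) \<in> pairs Q" if "j \<in> nbrs Q i" for i j
    using that mem_nbrs_sym[OF assms] by (auto simp: pairs_def)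
  have bin: "x $ i = 0 \<or> x $ i = 1" for i
    using x by (simp add: binary_vectors_def)
  have "x $ i + x $ j - x $ i * x $ j \<le> 1" "x $ i * x $ j + x $ j * x $ i - 2 * x $ i \<le> 0"
    "0 \<le> x $ i * x $ j" for i j
    using bin[of i] bin[of j] by auto
  then have "(x, ?y) \<in> PK Q"
    using bin by (simp add: PK_def mem)
  then show "x \<in> fst ` PK Q"
    by force
qed (auto simp: PK_def binary_vectors_def)

lemma milp_region_PK:
  fixes Q :: "real ^ 'n ^ 'n"
  assumes "transpose Q = Q"
  shows "milp_region Q (PK Q)"
proof -
  let ?e = "\<lambda>q p. of_bool (p = q) :: real"
  \<comment> \<open>In order: the two coupling families, the bounds \<open>x $ i \<le> 1\<close> and
    \<open>0 \<le> x $ i\<close>, and nonnegativity of \<open>y\<close>. Binarity is recovered from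
    the bounds and integrality of \<open>x\<close>; no \<open>y\<close> is required to be
    integral.\<close>
  define C :: "((real ^ 'n) \<times> ('n \<times> 'n \<Rightarrow> real) \<times> real) set" where
    "C = (\<lambda>(i, j). (axis i 1 + axis j 1, \<lambda>p. - ?e (i, j) p, 1)) ` pairs Q
       \<union> (\<lambda>(i, j). (axis i (-2), \<lambda>p. ?e (i, j) p + ?e (j, i) p, 0)) ` pairs Q
       \<union> range (\<lambda>i. (axis i 1, \<lambda>_. 0, 1))
       \<union> range (\<lambda>i. (axis i (-1), \<lambda>_. 0, 0))
       \<union> (\<lambda>q. (0, \<lambda>p. - ?e q p, 0)) ` pairs Q"
  have fin: "finite (pairs Q)"
    by simp
  have swap: "(j, i) \<in> pairs Q" if "(i, j) \<in> pairs Q" for i j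
    using that mem_nbrs_sym[OF assms] by (simp add: pairs_def)
  \<comment> \<open>These evaluate the left-hand sides for unit-vector coefficients.
    \<open>swap\<close> is needed because the coefficient at \<open>(j, i)\<close> only counts if
    that pair indexes a variable.\<close>
  note sums = sum_axis_mult sum_of_bool_mult[OF fin] sum.distrib distrib_right sum_negf swap
  have C: "(\<forall>(a, b, \<beta>)\<in>C. (\<Sum>i\<in>UNIV. a $ i * x $ i) + (\<Sum>p\<in>pairs Q. b p * y p) \<le> \<beta>) \<longleftrightarrow>
      (\<forall>(i, j)\<in>pairs Q. x $ i + x $ j - y (i, j) \<le> 1) \<and>
      (\<forall>(i, j)\<in>pairs Q. y (i, j) + y (j, i) - 2 * x $ i \<le> 0) \<and>
      (\<forall>i. x $ i \<le> 1) \<and> (\<forall>i. 0 \<le> x $ i) \<and> (\<forall>p\<in>pairs Q. 0 \<le> y p)" for x y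
    unfolding C_def ball_Un by (simp add: split_beta sums cong: ball_cong)
  have binary: "(\<forall>i. x $ i \<le> 1) \<and> (\<forall>i. 0 \<le> x $ i) \<and> (\<forall>i. x $ i \<in> \<int>) \<longleftrightarrow> (\<forall>i. x $ i \<in> {0, 1})"
    for x :: "real ^ 'n"
  proof -
    have "r \<le> 1 \<and> 0 \<le> r \<and> r \<in> \<int> \<longleftrightarrow> r \<in> {0, 1}" for r :: real
      by (auto elim!: Ints_cases)
    then show ?thesis
      by blast
  qed
  have "PK Q = {(x, y). y \<in> extensional (pairs Q) \<and>
      (\<forall>(a, b, \<beta>)\<in>C. (\<Sum>i\<in>UNIV. a $ i * x $ i) + (\<Sum>p\<in>pairs Q. b p * y p) \<le> \<beta>) \<and>
      (\<forall>i\<in>UNIV. x $ i \<in> \<int>) \<and> (\<forall>p\<in>{}. y p \<in> \<int>)}"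
    unfolding C PK_def binary[symmetric] by (auto simp: pairs_def)
  moreover have "finite C"
    unfolding C_def using fin by (intro finite_UnI finite_imageI) simp_all
  ultimately show ?thesis
    unfolding milp_region_def by blast
qed

theorem theorem1:
  fixes Q :: "real ^ 'n ^ 'n" and c :: "real ^ 'n"
  assumes "transpose Q = Q"
    and "\<And>i. Q $ i $ i = 0"
  shows "valid_MILP_formulation Q c (PK Q)"
proof -
  have obj: "linearized_obj Q c s = qubo_obj Q c (fst s)" if "s \<in> PK Q" for s
    using linearized_obj_PK[OF assms(1)] that by (cases s) simp
  note arg_max = is_arg_max_projection[OF fst_image_PK[OF assms(1)], of "linearized_obj Q c" "qubo_obj Q c", OF obj]
  have "(0 :: real ^ 'n) \<in> binary_vectors"
    by (simp add: binary_vectors_def)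
  then obtain x where x: "is_arg_max (qubo_obj Q c) (\<lambda>x. x \<in> binary_vectors) x"
    using ex_is_arg_max_if_finite[OF finite_binary_vectors] by blast
  \<comment> \<open>Existence of an optimum for \<open>PK\<close> comes from lifting a QUBO optimum,
    which exists by finiteness.\<close>
  then obtain s where s: "s \<in> PK Q" "fst s = x"
    by (metis fst_image_PK[OF assms(1)] image_iff is_arg_max_def)
  have "is_arg_max (linearized_obj Q c) (\<lambda>s. s \<in> PK Q) s"
    using arg_max s x by blast
  then have "is_optimal_value (linearized_obj Q c) (PK Q) (qubo_obj Q c x)"
    unfolding is_optimal_value_def using obj s by blast
  moreover have "is_optimal_value (qubo_obj Q c) binary_vectors (qubo_obj Q c x)"
    unfolding is_optimal_value_def using x by blast
  moreover have "is_arg_max (qubo_obj Q c) (\<lambda>x. x \<in> binary_vectors) x"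
    if "is_arg_max (linearized_obj Q c) (\<lambda>s. s \<in> PK Q) (x, y)" for x y
    using arg_max[of "(x, y)"] that by (simp add: is_arg_max_def)
  ultimately show ?thesis
    using milp_region_PK[OF assms(1)] by (auto simp: valid_MILP_formulation_def)
qed

end
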